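(* Let $\mathcal{H}$ be a complex Hilbert space, let $A, B \in \mathbb{B}(\mathcal{H})$ be two positive invertible operators and let $\nu \in (0,1)$. Then $$A\nabla_{\nu} B \geq A\sharp_{\nu} B + \sum_{k=0}^{\infty} r_k\Big[A\sharp_{\frac{m_k}{2^k}} B - 2\,A\sharp_{\frac{2m_k+1}{2^{k+1}}} B + A\sharp_{\frac{m_k+1}{2^k}} B\Big].$$
   Context: $\mathbb{B}(\mathcal{H})$ is the algebra of bounded linear operators on $\mathcal{H}$, and $\geq$ is the usual order on self-adjoint operators. For positive invertible $A,B$ and $\mu\in[0,1]$: $A\nabla_\mu B=(1-\mu)A+\mu B$ and $A\sharp_\mu B=A^{1/2}(A^{-1/2}BA^{-1/2})^{\mu}A^{1/2}$. For $0<\nu<1$ and integers $k\ge 0$, $m_k=\lfloor 2^k\nu\rfloor$ is the largest integer not greater than $2^k\nu$; $r_0=\min\{\nu,1-\nu\}$ and $r_k=\min\{2r_{k-1},\,1-2r_{k-1}\}$ for $k\ge 1$. The terms of the series are positive operators and the partial sums are bounded above; the infinite sum is the limit of the partial sums in the strong operator topology. *)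

theory Defs
  imports "HOL-Analysis.Analysis" "HOL-Computational_Algebra.Polynomial"
begin

(* A complex Hilbert space. Norm, topology, real scalar multiplication and completeness come from
   the library classes real_inner and banach; the real inner product is the real part of cinner, so
   positive definiteness of cinner is inherited. cinner is linear in its first argument. *)
class complex_hilbert = real_inner + banach +
  fixes scaleC :: "complex \<Rightarrow> 'a \<Rightarrow> 'a" (infixr "*\<^sub>C" 75)
    and cinner :: "'a \<Rightarrow> 'a \<Rightarrow> complex"
  assumes scaleC_add_right: "c *\<^sub>C (x + y) = c *\<^sub>C x + c *\<^sub>C y"
    and scaleC_add_left: "(c + d) *\<^sub>C x = c *\<^sub>C x + d *\<^sub>C x"
    and scaleC_scaleC: "c *\<^sub>C (d *\<^sub>C x) = (c * d) *\<^sub>C x"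
    and scaleC_of_real: "complex_of_real r *\<^sub>C x = r *\<^sub>R x"
    and cinner_commute: "cinner x y = cnj (cinner y x)"
    and cinner_add_left: "cinner (x + y) z = cinner x z + cinner y z"
    and cinner_scaleC_left: "cinner (c *\<^sub>C x) y = c * cinner x y"
    and inner_eq_Re_cinner: "inner x y = Re (cinner x y)"

(* The library type of bounded operators contains all bounded real-linear maps; B(H) consists of
   the complex-linear ones. *)
definition bounded_ops :: "('a::complex_hilbert \<Rightarrow>\<^sub>L 'a) set" where
  "bounded_ops = {T. \<forall>c x. blinfun_apply T (c *\<^sub>C x) = c *\<^sub>C blinfun_apply T x}"

definition selfadjoint_op :: "('a::complex_hilbert \<Rightarrow>\<^sub>L 'a) \<Rightarrow> bool" where
  "selfadjoint_op T \<longleftrightarrow> T \<in> bounded_ops \<and>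
     (\<forall>x y. cinner (blinfun_apply T x) y = cinner x (blinfun_apply T y))"

definition positive_op :: "('a::complex_hilbert \<Rightarrow>\<^sub>L 'a) \<Rightarrow> bool" where
  "positive_op T \<longleftrightarrow> selfadjoint_op T \<and> (\<forall>x. 0 \<le> Re (cinner (blinfun_apply T x) x))"

definition op_le :: "('a::complex_hilbert \<Rightarrow>\<^sub>L 'a) \<Rightarrow> ('a \<Rightarrow>\<^sub>L 'a) \<Rightarrow> bool" (infix "\<le>\<^sub>o\<^sub>p" 50) where
  "S \<le>\<^sub>o\<^sub>p T \<longleftrightarrow> selfadjoint_op S \<and> selfadjoint_op T \<and> positive_op (T - S)"

definition invertible_op :: "('a::complex_hilbert \<Rightarrow>\<^sub>L 'a) \<Rightarrow> bool" where
  "invertible_op T \<longleftrightarrow>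
     (\<exists>S\<in>bounded_ops. S o\<^sub>L T = id_blinfun \<and> T o\<^sub>L S = id_blinfun)"

(* The inverse of z I - T is written pointwise, as the operator type carries no complex scaling. *)
definition op_spectrum :: "('a::complex_hilbert \<Rightarrow>\<^sub>L 'a) \<Rightarrow> complex set" where
  "op_spectrum T = {z. \<not> (\<exists>S\<in>bounded_ops. \<forall>x.
      blinfun_apply S (z *\<^sub>C x - blinfun_apply T x) = x \<and>
      z *\<^sub>C blinfun_apply S x - blinfun_apply T (blinfun_apply S x) = x)}"

definition poly_op :: "real poly \<Rightarrow> ('a::complex_hilbert \<Rightarrow>\<^sub>L 'a) \<Rightarrow> 'a \<Rightarrow>\<^sub>L 'a" where
  "poly_op p T = (\<Sum>i\<le>degree p. coeff p i *\<^sub>R ((\<lambda>S. T o\<^sub>L S) ^^ i) id_blinfun)"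

(* Continuous functional calculus f(T) for self-adjoint T, whose spectrum is real, and f real-valued
   and continuous on that spectrum: the common norm limit of p_n(T) over all sequences of real
   polynomials p_n converging to f uniformly on the spectrum. *)
definition op_cfc :: "(real \<Rightarrow> real) \<Rightarrow> ('a::complex_hilbert \<Rightarrow>\<^sub>L 'a) \<Rightarrow> 'a \<Rightarrow>\<^sub>L 'a" where
  "op_cfc f T = (THE S. \<forall>p :: nat \<Rightarrow> real poly.
     uniform_limit {t. complex_of_real t \<in> op_spectrum T} (\<lambda>n t. poly (p n) t) f sequentially
       \<longrightarrow> (\<lambda>n. poly_op (p n) T) \<longlonglongrightarrow> S)"

(* T^s for positive invertible T and real s, also negative: the spectrum then lies in (0, \<infinity>),
   where t powr s is the usual power. *)
definition op_powr :: "('a::complex_hilbert \<Rightarrow>\<^sub>L 'a) \<Rightarrow> real \<Rightarrow> 'a \<Rightarrow>\<^sub>L 'a" where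
  "op_powr T s = op_cfc (\<lambda>t. t powr s) T"

definition arith_mean ::
    "('a::complex_hilbert \<Rightarrow>\<^sub>L 'a) \<Rightarrow> real \<Rightarrow> ('a \<Rightarrow>\<^sub>L 'a) \<Rightarrow> 'a \<Rightarrow>\<^sub>L 'a" where
  "arith_mean A \<mu> B = (1 - \<mu>) *\<^sub>R A + \<mu> *\<^sub>R B"

definition geom_mean ::
    "('a::complex_hilbert \<Rightarrow>\<^sub>L 'a) \<Rightarrow> real \<Rightarrow> ('a \<Rightarrow>\<^sub>L 'a) \<Rightarrow> 'a \<Rightarrow>\<^sub>L 'a" where
  "geom_mean A \<mu> B =
     op_powr A (1/2) o\<^sub>L
     op_powr (op_powr A (-1/2) o\<^sub>L B o\<^sub>L op_powr A (-1/2)) \<mu> o\<^sub>L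
     op_powr A (1/2)"

definition m_seq :: "real \<Rightarrow> nat \<Rightarrow> int" where
  "m_seq \<nu> k = \<lfloor>2 ^ k * \<nu>\<rfloor>"

primrec r_seq :: "real \<Rightarrow> nat \<Rightarrow> real" where
  "r_seq \<nu> 0 = min \<nu> (1 - \<nu>)"
| "r_seq \<nu> (Suc k) = min (2 * r_seq \<nu> k) (1 - 2 * r_seq \<nu> k)"

(* Convergence of operator series in the strong operator topology. *)
definition sot_sums :: "(nat \<Rightarrow> 'a::complex_hilbert \<Rightarrow>\<^sub>L 'a) \<Rightarrow> ('a \<Rightarrow>\<^sub>L 'a) \<Rightarrow> bool" where
  "sot_sums F S \<longleftrightarrow> (\<forall>x. (\<lambda>k. blinfun_apply (F k) x) sums blinfun_apply S x)"

definition sot_summable :: "(nat \<Rightarrow> 'a::complex_hilbert \<Rightarrow>\<^sub>L 'a) \<Rightarrow> bool" where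
  "sot_summable F \<longleftrightarrow> (\<exists>S. sot_sums F S)"

definition sot_suminf :: "(nat \<Rightarrow> 'a::complex_hilbert \<Rightarrow>\<^sub>L 'a) \<Rightarrow> 'a \<Rightarrow>\<^sub>L 'a" where
  "sot_suminf F = (THE S. sot_sums F S)"

end

(* The differences of consecutive piecewise linear interpolants of t |-> A #_t B on the dyadic grids
   of mesh 2^-k, taken at \<nu>, are exactly the terms of the series: r_k is the distance from 2^k \<nu> to
   the nearest integer, i.e. half the value at \<nu> of the tent function of height 1 over its dyadic
   interval. Hence the partial sums telescope. As t |-> A #_t B is norm continuous, the series even
   converges in norm, with sum A \<nabla>_\<nu> B - A #_\<nu> B, so that the inequality holds with equality.
   What remains is the functional calculus behind #, which rests on the bound of p(T) by the maximum
   of |p| on the spectrum, for T self-adjoint and p a real polynomial. *)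
theory Submission imports Defs "HOL-Computational_Algebra.Fundamental_Theorem_Algebra"
begin

section \<open>Self-adjoint and coercive operators\<close>

text \<open>The obstacle is the norm bound: the spectral radius formula would call for complex
  analysis of the resolvent, while the operator type has no complex scaling. The argument therefore
  stays real. A real polynomial splits into linear factors and quadratic factors without real zeros.
  For self-adjoint T the latter are a square plus a positive constant, hence harmless; a linear
  factor whose zero lies off the spectrum is invertible. Invertibility is then weakened to being
  bounded below, which passes to products at once and which fails for \<parallel>S\<parallel>^2 -
  S^2 whenever S is self-adjoint on a nonzero space. In the same spirit, adjointness is reduced to
  symmetry in the real inner product, and the inverses that locate the spectrum of a positive
  invertible operator come from coercivity and a fixed point argument. As \<open>op_cfc\<close>
  quantifies over all approximating sequences, existence of a limit has to be paired with its
  independence of the sequence.\<close>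

lemma scaleC_zero_right [simp]: "c *\<^sub>C (0::'a::complex_hilbert) = 0"
  using scaleC_add_right[of c 0 0] by simp

lemma scaleC_scaleR: "c *\<^sub>C (r *\<^sub>R (x::'a::complex_hilbert)) = r *\<^sub>R (c *\<^sub>C x)"
  by (metis mult.commute scaleC_of_real scaleC_scaleC)

lemma scaleC_minus_right: "c *\<^sub>C (- x) = - (c *\<^sub>C (x::'a::complex_hilbert))"
  using scaleC_scaleR[of c "-1" x] by simp

lemma scaleC_diff_right: "c *\<^sub>C (x - y) = c *\<^sub>C x - c *\<^sub>C (y::'a::complex_hilbert)"
  using scaleC_add_right[of c x "- y"] by (simp add: scaleC_minus_right)

lemma cinner_scaleC_right: "cinner x (c *\<^sub>C y) = cnj c * cinner (x::'a::complex_hilbert) y"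
  by (metis cinner_commute cinner_scaleC_left complex_cnj_mult)

text \<open>Multiplying the first argument by -i moves the imaginary part into the real part, so the
  real inner product and the complex structure determine \<open>cinner\<close>.\<close>

lemma cinner_eq_inner:
  "cinner x y = Complex (inner x y) (inner ((- \<i>) *\<^sub>C x) (y::'a::complex_hilbert))"
  by (simp add: complex_eq_iff inner_eq_Re_cinner cinner_scaleC_left)

lemma norm_scaleC: "norm (c *\<^sub>C (x::'a::complex_hilbert)) = cmod c * norm x"
proof -
  have "Im (cinner x x) = 0"
    using arg_cong[OF cinner_commute[of x x], of Im] by simp
  then have "inner (c *\<^sub>C x) (c *\<^sub>C x) = (cmod c)\<^sup>2 * inner x x"
    unfolding cmod_power2
    by (simp add: inner_eq_Re_cinner cinner_scaleC_left cinner_scaleC_right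
        algebra_simps power2_eq_square)
  then show ?thesis
    by (simp add: norm_eq_sqrt_inner real_sqrt_mult)
qed

lemma bounded_linear_scaleC: "bounded_linear (\<lambda>x::'a::complex_hilbert. c *\<^sub>C x)"
  by (rule bounded_linear_intro[where K = "cmod c"])
    (auto simp: scaleC_add_right scaleC_scaleR norm_scaleC)

lemma bounded_ops_scaleC:
  "T \<in> bounded_ops \<Longrightarrow> blinfun_apply T (c *\<^sub>C x) = c *\<^sub>C blinfun_apply T x"
  by (simp add: bounded_ops_def)

lemma bounded_ops_id: "id_blinfun \<in> bounded_ops"
  by (simp add: bounded_ops_def)

lemma bounded_ops_compose: "S \<in> bounded_ops \<Longrightarrow> T \<in> bounded_ops \<Longrightarrow> S o\<^sub>L T \<in> bounded_ops"
  by (simp add: bounded_ops_def)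

lemma bounded_ops_add: "S \<in> bounded_ops \<Longrightarrow> T \<in> bounded_ops \<Longrightarrow> S + T \<in> bounded_ops"
  by (simp add: bounded_ops_def blinfun.add_left scaleC_add_right)

lemma bounded_ops_diff: "S \<in> bounded_ops \<Longrightarrow> T \<in> bounded_ops \<Longrightarrow> S - T \<in> bounded_ops"
  by (simp add: bounded_ops_def blinfun.diff_left scaleC_diff_right)

lemma bounded_ops_scaleR: "T \<in> bounded_ops \<Longrightarrow> r *\<^sub>R T \<in> bounded_ops"
  by (simp add: bounded_ops_def blinfun.scaleR_left scaleC_scaleR)

text \<open>A complex-linear T commutes with multiplication by -i, so real symmetry applied to -i x
  yields the imaginary part as well. From here on only \<open>inner\<close> is used.\<close>

lemma selfadjoint_op_iff:
  "selfadjoint_op T \<longleftrightarrow> T \<in> bounded_ops \<and> (\<forall>x y. inner (T x) y = inner x (T y))"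
proof (intro iffI conjI allI)
  assume T: "selfadjoint_op T"
  then show "T \<in> bounded_ops" by (simp add: selfadjoint_op_def)
  show "inner (T x) y = inner x (T y)" for x y
    using T by (simp add: selfadjoint_op_def inner_eq_Re_cinner)
next
  assume T: "T \<in> bounded_ops \<and> (\<forall>x y. inner (T x) y = inner x (T y))"
  have "cinner (T x) y = cinner x (T y)" for x y
  proof -
    have "inner ((- \<i>) *\<^sub>C T x) y = inner (T ((- \<i>) *\<^sub>C x)) y"
      using T by (simp only: bounded_ops_scaleC)
    also have "\<dots> = inner ((- \<i>) *\<^sub>C x) (T y)"
      using T by blast
    finally show ?thesis
      using T by (simp add: cinner_eq_inner[of "T x"] cinner_eq_inner[of x])
  qed
  then show "selfadjoint_op T"
    using T by (simp add: selfadjoint_op_def)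
qed

lemma selfadjoint_op_inner: "selfadjoint_op T \<Longrightarrow> inner (T x) y = inner x (T y)"
  by (simp add: selfadjoint_op_iff)

lemma selfadjoint_op_bounded_ops: "selfadjoint_op T \<Longrightarrow> T \<in> bounded_ops"
  by (simp add: selfadjoint_op_def)

lemma positive_op_iff: "positive_op T \<longleftrightarrow> selfadjoint_op T \<and> (\<forall>x. 0 \<le> inner (T x) x)"
  by (simp add: positive_op_def inner_eq_Re_cinner)

lemma positive_op_selfadjoint: "positive_op T \<Longrightarrow> selfadjoint_op T"
  by (simp add: positive_op_def)

lemma selfadjoint_op_id: "selfadjoint_op id_blinfun"
  by (simp add: selfadjoint_op_iff bounded_ops_id)

lemma selfadjoint_op_zero: "selfadjoint_op 0"
  by (simp add: selfadjoint_op_iff bounded_ops_def)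

lemma selfadjoint_op_add: "selfadjoint_op S \<Longrightarrow> selfadjoint_op T \<Longrightarrow> selfadjoint_op (S + T)"
  by (simp add: selfadjoint_op_iff bounded_ops_add blinfun.add_left inner_left_distrib
      inner_right_distrib)

lemma selfadjoint_op_scaleR: "selfadjoint_op T \<Longrightarrow> selfadjoint_op (r *\<^sub>R T)"
  by (simp add: selfadjoint_op_iff bounded_ops_scaleR blinfun.scaleR_left)

lemma selfadjoint_op_compose:
  assumes "selfadjoint_op S" "selfadjoint_op T" "S o\<^sub>L T = T o\<^sub>L S"
  shows "selfadjoint_op (S o\<^sub>L T)"
proof -
  have "inner (S (T x)) y = inner x (S (T y))" for x y
    using assms by (metis blinfun_apply_blinfun_compose selfadjoint_op_inner)
  then show ?thesis
    using assms by (simp add: selfadjoint_op_iff bounded_ops_compose)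
qed

lemma selfadjoint_op_sandwich:
  assumes "selfadjoint_op S" "selfadjoint_op T"
  shows "selfadjoint_op (S o\<^sub>L T o\<^sub>L S)"
  using assms by (simp add: selfadjoint_op_iff bounded_ops_compose)

lemma selfadjoint_op_lim:
  assumes T: "\<And>n. selfadjoint_op (T n)" and lim: "T \<longlonglongrightarrow> S"
  shows "selfadjoint_op S"
proof -
  have app: "(\<lambda>n. T n x) \<longlonglongrightarrow> S x" for x
    by (intro tendsto_intros lim)
  have "S (c *\<^sub>C x) = c *\<^sub>C S x" for c x
  proof (rule LIMSEQ_unique[OF app])
    have "(\<lambda>n. c *\<^sub>C T n x) \<longlonglongrightarrow> c *\<^sub>C S x"
      by (rule bounded_linear.tendsto[OF bounded_linear_scaleC app])
    then show "(\<lambda>n. T n (c *\<^sub>C x)) \<longlonglongrightarrow> c *\<^sub>C S x"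
      using T by (simp add: bounded_ops_scaleC selfadjoint_op_bounded_ops)
  qed
  moreover have "inner (S x) y = inner x (S y)" for x y
  proof (rule LIMSEQ_unique)
    show "(\<lambda>n. inner (T n x) y) \<longlonglongrightarrow> inner (S x) y"
      by (intro tendsto_intros app)
    show "(\<lambda>n. inner (T n x) y) \<longlonglongrightarrow> inner x (S y)"
      unfolding selfadjoint_op_inner[OF T] by (intro tendsto_intros app)
  qed
  ultimately show ?thesis
    by (simp add: selfadjoint_op_iff bounded_ops_def)
qed

section \<open>Coercive operators and the location of the real spectrum\<close>

lemma coercive_lower_bound:
  fixes T :: "'a::real_inner \<Rightarrow>\<^sub>L 'a"
  assumes "\<And>x. \<alpha> * (norm x)\<^sup>2 \<le> inner (T x) x"
  shows "\<alpha> * norm x \<le> norm (T x)"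
proof (cases "x = 0")
  case False
  have "\<alpha> * norm x * norm x \<le> norm (T x) * norm x"
    using assms[of x] norm_cauchy_schwarz[of "T x" x] by (simp add: power2_eq_square)
  then show ?thesis using False by simp
qed simp

text \<open>The Lax-Milgram argument: a solution of T x = y is a fixed point of x |-> x - e (T x -
  y), which is a contraction for small e.\<close>

lemma coercive_surj:
  fixes T :: "'a::{real_inner,banach} \<Rightarrow>\<^sub>L 'a"
  assumes \<alpha>: "0 < \<alpha>" and coer: "\<And>x. \<alpha> * (norm x)\<^sup>2 \<le> inner (T x) x"
  shows "\<exists>x. T x = y"
proof -
  define M where "M = norm T + \<alpha>"
  have M: "0 < M" "norm T \<le> M" "\<alpha> \<le> M" using \<alpha> by (auto simp: M_def add_nonneg_pos)
  \<comment> \<open>This e minimises 1 - 2 e \<alpha> + e^2 M^2, the bound for the squared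
    contraction factor; the minimum is c^2. The choice of \<open>M\<close> gives \<alpha> \<le> M,
    so the root is real.\<close>
  define e where "e = \<alpha> / M\<^sup>2"
  define c where "c = sqrt (1 - (\<alpha> / M)\<^sup>2)"
  have e: "0 < e" using \<alpha> M by (simp add: e_def)
  have q: "0 < (\<alpha> / M)\<^sup>2" "(\<alpha> / M)\<^sup>2 \<le> 1"
    using \<alpha> M by (auto simp: power_le_one)
  have c: "0 \<le> c" "c < 1" using q by (auto simp: c_def)
  have contr: "norm (x - e *\<^sub>R T x) \<le> c * norm x" for x
  proof -
    have "norm (T x) \<le> M * norm x"
      using norm_blinfun[of T x] M(2) by (meson mult_right_mono norm_ge_zero order_trans)
    then have "(norm (T x))\<^sup>2 \<le> M\<^sup>2 * (norm x)\<^sup>2"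
      by (metis norm_ge_zero power_mono power_mult_distrib)
    then have 1: "e\<^sup>2 * (norm (T x))\<^sup>2 \<le> e\<^sup>2 * (M\<^sup>2 * (norm x)\<^sup>2)"
      by (simp add: mult_left_mono)
    have "(norm (x - e *\<^sub>R T x))\<^sup>2 = (norm x)\<^sup>2 - 2 * (e * inner (T x) x) + e\<^sup>2 * (norm (T x))\<^sup>2"
      unfolding power2_norm_eq_inner
      by (simp add: inner_diff_left inner_diff_right inner_commute power2_eq_square right_diff_distrib)
    also have "\<dots> \<le> (norm x)\<^sup>2 - 2 * (e * (\<alpha> * (norm x)\<^sup>2)) + e\<^sup>2 * (M\<^sup>2 * (norm x)\<^sup>2)"
      using 1 mult_left_mono[OF coer[of x], of e] e by linarith
    also have "\<dots> = (1 - (\<alpha> / M)\<^sup>2) * (norm x)\<^sup>2"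
      using M(1) by (simp add: e_def field_simps power2_eq_square)
    also have "\<dots> = (c * norm x)\<^sup>2"
      using q by (simp add: c_def power_mult_distrib)
    finally show ?thesis
      by (rule power2_le_imp_le) (use c in auto)
  qed
  have "\<exists>!x. x - e *\<^sub>R (T x - y) = x"
  proof (rule banach_fix_type[OF c], intro allI)
    show "dist (x - e *\<^sub>R (T x - y)) (z - e *\<^sub>R (T z - y)) \<le> c * dist x z" for x z
    proof -
      have "x - e *\<^sub>R (T x - y) - (z - e *\<^sub>R (T z - y)) = (x - z) - e *\<^sub>R T (x - z)"
        by (simp add: blinfun.diff_right algebra_simps)
      then show ?thesis using contr[of "x - z"] by (simp only: dist_norm)
    qed
  qed
  then show ?thesis using e by auto
qed

text \<open>The lower bound makes preimages unique, so preimages picked by choice depend linearly on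
  the point, are bounded by 1 / \<alpha> and, T being complex-linear, respect complex
  scalars.\<close>

lemma coercive_inverse:
  fixes T :: "'a::complex_hilbert \<Rightarrow>\<^sub>L 'a"
  assumes T: "T \<in> bounded_ops"
    and \<alpha>: "0 < \<alpha>" and coer: "\<And>x. \<alpha> * (norm x)\<^sup>2 \<le> inner (T x) x"
  obtains S where "S \<in> bounded_ops" "\<And>x. S (T x) = x" "\<And>x. T (S x) = x"
proof -
  define g where "g y = (SOME x. T x = y)" for y
  have Tg: "T (g y) = y" for y
    unfolding g_def using someI_ex[OF coercive_surj[OF \<alpha> coer]] .
  have eqI: "x = y" if "T x = T y" for x y
  proof -
    have "\<alpha> * norm (x - y) \<le> 0"
      using coercive_lower_bound[OF coer, of "x - y"] that by (simp add: blinfun.diff_right)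
    then show ?thesis using \<alpha> by (simp add: mult_le_0_iff)
  qed
  have "bounded_linear g"
  proof (rule bounded_linear_intro[where K = "1 / \<alpha>"])
    show "norm (g y) \<le> norm y * (1 / \<alpha>)" for y
      using coercive_lower_bound[OF coer, of "g y"] \<alpha> by (simp add: Tg field_simps)
  qed (rule eqI, simp add: Tg blinfun.add_right blinfun.scaleR_right)+
  then have S: "blinfun_apply (Blinfun g) = g"
    by (rule bounded_linear_Blinfun_apply)
  show ?thesis
  proof
    show "Blinfun g \<in> bounded_ops"
      unfolding bounded_ops_def mem_Collect_eq S
      by (intro allI, rule eqI) (simp add: Tg bounded_ops_scaleC T)
  qed (simp_all add: S Tg eqI)
qed

text \<open>Positivity gives T^2 \<le> N T for N above the norm of T, and invertibility bounds
  \<parallel>x\<parallel> by a multiple of \<parallel>T x\<parallel>; chaining the two gives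
  coercivity.\<close>

lemma positive_invertible_coercive:
  fixes T :: "'a::complex_hilbert \<Rightarrow>\<^sub>L 'a"
  assumes "positive_op T" and "invertible_op T"
  obtains \<alpha> where "0 < \<alpha>" "\<And>x. \<alpha> * (norm x)\<^sup>2 \<le> inner (T x) x"
proof -
  have sym: "inner (T x) y = inner x (T y)" and pos: "0 \<le> inner (T x) x" for x y
    using assms(1) by (auto simp: positive_op_iff selfadjoint_op_inner)
  obtain S where S: "S o\<^sub>L T = id_blinfun"
    using assms(2) by (auto simp: invertible_op_def)
  define N where "N = norm T + 1"
  define M where "M = norm S + 1"
  have N: "0 < N" "norm T \<le> N" by (auto simp: N_def add_nonneg_pos)
  have M: "0 < M" "norm S \<le> M" by (auto simp: M_def add_nonneg_pos)
  have Tb: "norm (T z) \<le> N * norm z" for z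
    using norm_blinfun[of T z] N(2) by (meson mult_right_mono norm_ge_zero order_trans)
  have "1 / (M\<^sup>2 * N) * (norm x)\<^sup>2 \<le> inner (T x) x" for x
  proof -
    \<comment> \<open>Testing positivity at N x - T x yields T^2 \<le> N T directly, where the usual
      proof would take a square root of T.\<close>
    have "0 \<le> inner (T (N *\<^sub>R x - T x)) (N *\<^sub>R x - T x)" by (rule pos)
    also have "\<dots> = N\<^sup>2 * inner (T x) x - 2 * N * (norm (T x))\<^sup>2 + inner (T (T x)) (T x)"
      using sym[of "T x" x] unfolding power2_norm_eq_inner
      by (simp add: blinfun.diff_right blinfun.scaleR_right inner_diff_left inner_diff_right
          power2_eq_square right_diff_distrib)
    also have "inner (T (T x)) (T x) \<le> N * (norm (T x))\<^sup>2"
      using norm_cauchy_schwarz[of "T (T x)" "T x"] mult_right_mono[OF Tb[of "T x"], of "norm (T x)"]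
      by (simp add: power2_eq_square)
    finally have "0 \<le> N * (N * inner (T x) x - (norm (T x))\<^sup>2)"
      by (simp add: algebra_simps power2_eq_square)
    then have 1: "(norm (T x))\<^sup>2 \<le> N * inner (T x) x"
      using N(1) by (simp add: zero_le_mult_iff)
    have "norm x = norm (S (T x))"
      using S by (metis blinfun_apply_blinfun_compose blinfun_apply_id_blinfun)
    also have "\<dots> \<le> M * norm (T x)"
      using norm_blinfun[of S "T x"] M(2) by (meson mult_right_mono norm_ge_zero order_trans)
    finally have "(norm x)\<^sup>2 \<le> M\<^sup>2 * (norm (T x))\<^sup>2"
      by (metis norm_ge_zero power_mono power_mult_distrib)
    also have "\<dots> \<le> M\<^sup>2 * (N * inner (T x) x)"
      using 1 by (simp add: mult_left_mono)
    finally show ?thesis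
      using M N by (simp add: field_simps)
  qed
  then show ?thesis
    using that[of "1 / (M\<^sup>2 * N)"] M N by simp
qed

lemma of_real_in_spectrum_iff:
  "complex_of_real t \<in> op_spectrum T \<longleftrightarrow> \<not> (\<exists>S\<in>bounded_ops. \<forall>x.
     S (t *\<^sub>R x - T x) = x \<and> t *\<^sub>R S x - T (S x) = x)"
  by (simp add: op_spectrum_def scaleC_of_real)

text \<open>Below \<alpha> the operator T - t is coercive, above the norm t - T is; either way there
  is an inverse.\<close>

lemma spectrum_bounds:
  fixes T :: "'a::complex_hilbert \<Rightarrow>\<^sub>L 'a"
  assumes T: "T \<in> bounded_ops" and coer: "\<And>x. \<alpha> * (norm x)\<^sup>2 \<le> inner (T x) x"
    and t: "complex_of_real t \<in> op_spectrum T"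
  shows "t \<in> {\<alpha>..norm T}"
proof (rule ccontr)
  assume "t \<notin> {\<alpha>..norm T}"
  then consider "t < \<alpha>" | "norm T < t" by force
  then show False
  proof cases
    case 1
    define Q where "Q = T - t *\<^sub>R id_blinfun"
    have Q: "Q x = T x - t *\<^sub>R x" for x
      by (simp add: Q_def blinfun.diff_left blinfun.scaleR_left)
    have "Q \<in> bounded_ops"
      by (simp add: Q_def T bounded_ops_diff bounded_ops_scaleR bounded_ops_id)
    moreover have "(\<alpha> - t) * (norm x)\<^sup>2 \<le> inner (Q x) x" for x
      using coer[of x] by (simp add: Q inner_diff_left power2_norm_eq_inner algebra_simps)
    ultimately obtain S where S: "S \<in> bounded_ops" "\<And>x. S (Q x) = x" "\<And>x. Q (S x) = x"
      using 1 by (auto intro: coercive_inverse[of Q "\<alpha> - t"])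
    \<comment> \<open>\<open>op_spectrum\<close> is phrased with t - T, while the coercive operator
      here is T - t; hence the sign.\<close>
    have "(- S) \<in> bounded_ops"
      using bounded_ops_scaleR[OF S(1), of "-1"] by simp
    moreover have "(- S) (t *\<^sub>R x - T x) = x" "t *\<^sub>R (- S) x - T ((- S) x) = x" for x
      using S(2)[of x] S(3)[of x] by (auto simp: Q blinfun.minus_left blinfun.minus_right blinfun.diff_right)
    ultimately show False
      using t unfolding of_real_in_spectrum_iff by blast
  next
    case 2
    define Q where "Q = t *\<^sub>R id_blinfun - T"
    have Q: "Q x = t *\<^sub>R x - T x" for x
      by (simp add: Q_def blinfun.diff_left blinfun.scaleR_left)
    have "Q \<in> bounded_ops"
      by (simp add: Q_def T bounded_ops_diff bounded_ops_scaleR bounded_ops_id)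
    moreover have "(t - norm T) * (norm x)\<^sup>2 \<le> inner (Q x) x" for x
    proof -
      have "inner (T x) x \<le> norm T * norm x * norm x"
        using norm_cauchy_schwarz[of "T x" x] norm_blinfun[of T x]
        by (meson mult_right_mono norm_ge_zero order_trans)
      then show ?thesis
        by (simp add: Q inner_diff_left power2_norm_eq_inner[symmetric] power2_eq_square algebra_simps)
    qed
    ultimately obtain S where S: "S \<in> bounded_ops" "\<And>x. S (Q x) = x" "\<And>x. Q (S x) = x"
      using 2 by (auto intro: coercive_inverse[of Q "t - norm T"])
    then show False
      using t unfolding of_real_in_spectrum_iff by (auto simp: Q)
  qed
qed

section \<open>Real polynomials of a self-adjoint operator\<close>

lemmas blinfun_compose_add_left = bounded_bilinear.add_left[OF bounded_bilinear_blinfun_compose]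
  and blinfun_compose_scaleR_left = bounded_bilinear.scaleR_left[OF bounded_bilinear_blinfun_compose]
  and blinfun_compose_scaleR_right = bounded_bilinear.scaleR_right[OF bounded_bilinear_blinfun_compose]
  and blinfun_compose_sum_right = bounded_bilinear.sum_right[OF bounded_bilinear_blinfun_compose]

text \<open>Padding with zero coefficients gives several polynomials a common summation range,
  although degrees may drop under addition.\<close>

lemma poly_op_eq_sum:
  assumes "degree p \<le> n"
  shows "poly_op p T = (\<Sum>i\<le>n. coeff p i *\<^sub>R ((\<lambda>S. T o\<^sub>L S) ^^ i) id_blinfun)"
  unfolding poly_op_def using assms
  by (intro sum.mono_neutral_left) (auto simp: coeff_eq_0)

lemma poly_op_0 [simp]: "poly_op 0 T = 0"
  by (simp add: poly_op_def)

lemma poly_op_add: "poly_op (p + q) T = poly_op p T + poly_op q T"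
proof -
  define n where "n = max (degree p) (degree q)"
  have "degree p \<le> n" "degree q \<le> n" "degree (p + q) \<le> n"
    by (auto simp: n_def degree_add_le)
  then show ?thesis
    by (simp add: poly_op_eq_sum[where n = n] sum.distrib scaleR_add_left)
qed

lemma poly_op_smult: "poly_op (smult c p) T = c *\<^sub>R poly_op p T"
  by (simp add: poly_op_eq_sum[where n = "degree p"] scaleR_sum_right degree_smult_le)

lemma poly_op_diff: "poly_op (p - q) T = poly_op p T - poly_op q T"
  using poly_op_add[of "p - q" q T] by simp

text \<open>Horner's scheme; it turns multiplicativity and self-adjointness of p(T) into inductions
  over \<open>pCons\<close>.\<close>

lemma poly_op_pCons:
  "poly_op (pCons a p) T = a *\<^sub>R id_blinfun + (T o\<^sub>L poly_op p T)"
proof -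
  have "poly_op (pCons a p) T =
      (\<Sum>i\<le>Suc (degree p). coeff (pCons a p) i *\<^sub>R ((\<lambda>S. T o\<^sub>L S) ^^ i) id_blinfun)"
    by (rule poly_op_eq_sum) (simp add: degree_pCons_le)
  also have "\<dots> = a *\<^sub>R id_blinfun +
      (\<Sum>i\<le>degree p. coeff p i *\<^sub>R (T o\<^sub>L ((\<lambda>S. T o\<^sub>L S) ^^ i) id_blinfun))"
    by (simp add: sum.atMost_Suc_shift del: sum.atMost_Suc)
  finally show ?thesis
    by (simp add: poly_op_def blinfun_compose_sum_right blinfun_compose_scaleR_right)
qed

lemma blinfun_compose_id [simp]: "T o\<^sub>L id_blinfun = T" "id_blinfun o\<^sub>L T = T"
  by (auto intro!: blinfun_eqI)

lemma blinfun_compose_assoc': "(R o\<^sub>L S) o\<^sub>L T = R o\<^sub>L (S o\<^sub>L T)"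
  by (rule blinfun_eqI) simp

lemma poly_op_const: "poly_op [:c:] T = c *\<^sub>R id_blinfun"
  by (simp add: poly_op_pCons)

lemma poly_op_X: "poly_op [:0, 1:] T = T"
  by (simp add: poly_op_pCons)

lemma poly_op_mult: "poly_op (p * q) T = poly_op p T o\<^sub>L poly_op q T"
proof (induction p)
  case (pCons a p)
  then show ?case
    by (simp add: mult_pCons_left poly_op_add poly_op_smult poly_op_pCons blinfun_compose_add_left
        blinfun_compose_scaleR_left blinfun_compose_assoc')
qed simp

lemma poly_op_commute: "poly_op p T o\<^sub>L poly_op q T = poly_op q T o\<^sub>L poly_op p T"
  by (metis mult.commute poly_op_mult)

lemma selfadjoint_poly_op:
  assumes "selfadjoint_op T"
  shows "selfadjoint_op (poly_op p T)"
proof (induction p)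
  case (pCons a p)
  have "T o\<^sub>L poly_op p T = poly_op p T o\<^sub>L T"
    using poly_op_commute[of "[:0, 1:]" T p] by (simp add: poly_op_X)
  then show ?case
    using pCons assms
    by (simp add: poly_op_pCons selfadjoint_op_add selfadjoint_op_scaleR selfadjoint_op_id
        selfadjoint_op_compose)
qed (simp add: selfadjoint_op_zero)

text \<open>Equivalently, 0 is not an approximate eigenvalue. Unlike invertibility, this involves no
  range condition.\<close>

definition bounded_below :: "('a::real_normed_vector \<Rightarrow>\<^sub>L 'a) \<Rightarrow> bool" where
  "bounded_below T \<longleftrightarrow> (\<exists>e>0. \<forall>x. e * norm x \<le> norm (T x))"

lemma bounded_below_compose:
  assumes "bounded_below S" "bounded_below T"
  shows "bounded_below (S o\<^sub>L T)"
proof -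
  obtain d e where d: "d > 0" "\<And>x. d * norm x \<le> norm (S x)"
    and e: "e > 0" "\<And>x. e * norm x \<le> norm (T x)"
    using assms by (auto simp: bounded_below_def)
  have "d * e * norm x \<le> norm (S (T x))" for x
  proof -
    have "d * (e * norm x) \<le> d * norm (T x)"
      using d(1) e(2) by (simp add: mult_left_mono)
    also have "\<dots> \<le> norm (S (T x))" by (rule d(2))
    finally show ?thesis by (simp add: mult.assoc)
  qed
  then show ?thesis
    using d(1) e(1) by (auto simp: bounded_below_def intro!: exI[of _ "d * e"])
qed

lemma not_in_spectrum_bounded_below:
  assumes "complex_of_real t \<notin> op_spectrum T"
  shows "bounded_below (T - t *\<^sub>R id_blinfun)"
proof -
  obtain S where S: "\<And>x. blinfun_apply S (t *\<^sub>R x - T x) = x"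
    using assms by (auto simp: of_real_in_spectrum_iff)
  have "1 / (norm S + 1) * norm x \<le> norm ((T - t *\<^sub>R id_blinfun) x)" for x
  proof -
    have "norm x \<le> norm S * norm (t *\<^sub>R x - T x)"
      using norm_blinfun[of S "t *\<^sub>R x - T x"] by (simp add: S)
    also have "\<dots> \<le> (norm S + 1) * norm (t *\<^sub>R x - T x)"
      by (simp add: mult_right_mono)
    finally have "norm x \<le> (norm S + 1) * norm (T x - t *\<^sub>R x)"
      by (simp add: norm_minus_commute)
    moreover have "0 < norm S + 1" by (simp add: add_nonneg_pos)
    ultimately show ?thesis
      by (simp add: field_simps blinfun.diff_left blinfun.scaleR_left)
  qed
  moreover have "0 < 1 / (norm S + 1)" by (simp add: add_nonneg_pos)
  ultimately show ?thesis
    unfolding bounded_below_def by blast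
qed

text \<open>A complex zero z exists. If it is not real, the quadratic is the monic real polynomial
  with zeros z and its conjugate, with a = Re z and b = Im z.\<close>

lemma real_poly_linear_or_quadratic_factor:
  fixes p :: "real poly"
  assumes "0 < degree p"
  obtains t r where "p = [:- t, 1:] * r"
  | a b r where "b \<noteq> 0" "p = [:a\<^sup>2 + b\<^sup>2, - 2 * a, 1:] * r"
proof -
  let ?cp = "map_poly complex_of_real"
  have deg: "degree (?cp p) = degree p"
    by (simp add: degree_map_poly)
  then obtain z where z: "poly (?cp p) z = 0"
    using fundamental_theorem_of_algebra[of "?cp p"] constant_degree[of "?cp p"] assms by auto
  show ?thesis
  proof (cases "Im z = 0")
    case True
    then have "z = complex_of_real (Re z)" by (simp add: complex_eq_iff)
    moreover have "poly (?cp p) (complex_of_real x) = complex_of_real (poly p x)" for x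
      by (induction p) (auto simp: map_poly_pCons)
    ultimately have "poly p (Re z) = 0"
      using z by (metis of_real_eq_0_iff)
    then have "[:- Re z, 1:] dvd p"
      by (simp add: poly_eq_0_iff_dvd)
    then show ?thesis using that(1) by (auto elim: dvdE)
  next
    case False
    define q where "q = [:(Re z)\<^sup>2 + (Im z)\<^sup>2, - 2 * Re z, 1:]"
    have degq: "degree q = 2" by (simp add: q_def)
    have q0: "q \<noteq> 0" by (simp add: q_def)
    have qz: "poly (?cp q) z = 0"
      by (simp add: q_def map_poly_pCons complex_eq_iff power2_eq_square algebra_simps)
    \<comment> \<open>A real polynomial of degree at most 1 with a non-real zero is 0: the imaginary
      part kills the slope, then the real part kills the constant.\<close>
    define s where "s = p mod q"
    have "degree s \<le> 1"
      using degree_mod_less[OF q0, of p] degq by (auto simp: s_def)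
    then have s: "s = [:coeff s 0, coeff s 1:]"
      by (intro poly_eqI) (auto simp: coeff_pCons coeff_eq_0 split: nat.splits)
    have "p = q * (p div q) + s" by (simp add: s_def)
    then have "?cp p = ?cp (q * (p div q) + s)" by simp
    also have "\<dots> = ?cp q * ?cp (p div q) + ?cp s"
      by (rule poly_eqI) (simp only: coeff_map_poly coeff_mult coeff_add of_real_0 of_real_add
          of_real_sum of_real_mult)
    finally have "?cp p = ?cp q * ?cp (p div q) + ?cp s" .
    then have "poly (?cp s) z = 0"
      using z qz by simp
    then have "complex_of_real (coeff s 0) + z * complex_of_real (coeff s 1) = 0"
      by (subst (asm) s) (simp add: map_poly_pCons)
    then have "coeff s 1 = 0" "coeff s 0 = 0"
      using False by (auto simp: complex_eq_iff)
    then have "s = 0" using s by simp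
    then have "p = q * (p div q)" using \<open>p = q * (p div q) + s\<close> by simp
    then show ?thesis using that(2)[OF False] by (simp add: q_def)
  qed
qed

text \<open>The operator is (T - a)^2 + b^2, and self-adjointness makes the square positive. This
  stands in for the fact that the spectrum of T is real.\<close>

lemma bounded_below_quadratic:
  assumes T: "selfadjoint_op T" and b: "b \<noteq> 0"
  shows "bounded_below (poly_op [:a\<^sup>2 + b\<^sup>2, - 2 * a, 1:] T)"
proof -
  let ?Q = "poly_op [:a\<^sup>2 + b\<^sup>2, - 2 * a, 1:] T"
  define U where "U = poly_op [:- a, 1:] T"
  have U: "selfadjoint_op U" unfolding U_def by (rule selfadjoint_poly_op[OF T])
  have "[:a\<^sup>2 + b\<^sup>2, - 2 * a, 1:] = [:- a, 1:] * [:- a, 1:] + [:b\<^sup>2:]"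
    by (simp add: power2_eq_square)
  then have Q: "?Q = (U o\<^sub>L U) + b\<^sup>2 *\<^sub>R id_blinfun"
    by (simp only: poly_op_add poly_op_mult poly_op_const U_def)
  have "b\<^sup>2 * (norm x)\<^sup>2 \<le> inner (?Q x) x" for x
    using selfadjoint_op_inner[OF U, of "U x" x]
    unfolding Q by (simp add: blinfun.add_left blinfun.scaleR_left inner_add_left power2_norm_eq_inner)
  then have "b\<^sup>2 * norm x \<le> norm (?Q x)" for x
    by (rule coercive_lower_bound)
  then show ?thesis
    using b unfolding bounded_below_def by (intro exI[of _ "b\<^sup>2"]) auto
qed

text \<open>One half of the spectral mapping theorem, by induction on the degree: each linear or
  quadratic factor is bounded below, hence so is the product.\<close>

lemma bounded_below_poly_op:
  assumes T: "selfadjoint_op T" and "p \<noteq> 0"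
    and "\<And>t. complex_of_real t \<in> op_spectrum T \<Longrightarrow> poly p t \<noteq> 0"
  shows "bounded_below (poly_op p T)"
  using assms(2,3)
proof (induction "degree p" arbitrary: p rule: less_induct)
  case (less p)
  show ?case
  proof (cases "degree p = 0")
    case True
    then obtain c where "p = [:c:]" by (auto elim: degree_eq_zeroE)
    then show ?thesis
      using less.prems(1)
      by (auto simp: poly_op_const bounded_below_def blinfun.scaleR_left intro!: exI[of _ "\<bar>c\<bar>"])
  next
    case False
    then have "0 < degree p" by simp
    then show ?thesis
    proof (cases rule: real_poly_linear_or_quadratic_factor)
      case (1 t r)
      have r: "r \<noteq> 0" using less.prems(1) 1 by auto
      have "degree p = 1 + degree r" by (subst 1, subst degree_mult_eq) (use r in auto)
      then have "bounded_below (poly_op r T)"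
        using less.hyps[of r] r less.prems(2) by (auto simp: 1)
      moreover have "complex_of_real t \<notin> op_spectrum T"
        using less.prems(2)[of t] by (auto simp: 1)
      then have "bounded_below (T - t *\<^sub>R id_blinfun)"
        by (rule not_in_spectrum_bounded_below)
      moreover have "poly_op [:- t, 1:] T = T - t *\<^sub>R id_blinfun"
        by (simp add: poly_op_pCons)
      ultimately show ?thesis
        unfolding 1 by (simp add: poly_op_mult bounded_below_compose del: mult_pCons_left)
    next
      case (2 b a r)
      have r: "r \<noteq> 0" using less.prems(1) 2 by auto
      have "degree p = 2 + degree r" by (subst 2(2), subst degree_mult_eq) (use r in auto)
      then have "bounded_below (poly_op r T)"
        using less.hyps[of r] r less.prems(2) by (auto simp: 2(2) simp del: mult_pCons_left)
      then show ?thesis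
        unfolding 2(2) using bounded_below_quadratic[OF T 2(1)]
        by (simp add: poly_op_mult bounded_below_compose del: mult_pCons_left)
    qed
  qed
qed

text \<open>Unit vectors that nearly attain \<parallel>S\<parallel> are approximate eigenvectors of
  S^2 for the value \<parallel>S\<parallel>^2. The proof runs the contrapositive, so no such
  sequence has to be chosen.\<close>

lemma selfadjoint_norm_not_bounded_below:
  fixes S :: "'a::complex_hilbert \<Rightarrow>\<^sub>L 'a"
  assumes S: "selfadjoint_op S" and nontriv: "\<exists>x::'a. x \<noteq> 0"
  shows "\<not> bounded_below ((norm S)\<^sup>2 *\<^sub>R id_blinfun - (S o\<^sub>L S))"
proof
  define c where "c = norm S"
  assume "bounded_below ((norm S)\<^sup>2 *\<^sub>R id_blinfun - (S o\<^sub>L S))"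
  then obtain e where e: "e > 0" "\<And>x. e * norm x \<le> norm (c\<^sup>2 *\<^sub>R x - S (S x))"
    by (auto simp: bounded_below_def c_def blinfun.diff_left blinfun.scaleR_left)
  have c0: "0 \<le> c" by (simp add: c_def)
  have Sb: "norm (S x) \<le> c * norm x" for x
    unfolding c_def by (rule norm_blinfun)
  \<comment> \<open>expanding \<open>\<parallel>c\<^sup>2 x - S\<^sup>2 x\<parallel>\<^sup>2\<close> shows that \<open>\<parallel>S x\<parallel>\<close> stays away from \<open>c \<parallel>x\<parallel>\<close>\<close>
  have key: "e\<^sup>2 * (norm x)\<^sup>2 + c\<^sup>2 * (norm (S x))\<^sup>2 \<le> c\<^sup>2 * (c\<^sup>2 * (norm x)\<^sup>2)" for x
  proof -
    have "(e * norm x)\<^sup>2 \<le> (norm (c\<^sup>2 *\<^sub>R x - S (S x)))\<^sup>2"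
      using e by (intro power_mono) auto
    also have "\<dots> = c\<^sup>2 * (c\<^sup>2 * (norm x)\<^sup>2) - 2 * c\<^sup>2 * (norm (S x))\<^sup>2 + (norm (S (S x)))\<^sup>2"
      using selfadjoint_op_inner[OF S, of "S x" x]
      unfolding power2_norm_eq_inner
      by (simp add: inner_diff_left inner_diff_right inner_commute right_diff_distrib)
    also have "(norm (S (S x)))\<^sup>2 \<le> c\<^sup>2 * (norm (S x))\<^sup>2"
      using power_mono[OF Sb[of "S x"], of 2] by (simp add: power_mult_distrib)
    finally show ?thesis by (simp add: power_mult_distrib)
  qed
  show False
  proof (cases "c = 0")
    case True
    obtain x :: 'a where "x \<noteq> 0" using nontriv by blast
    then have "0 < e\<^sup>2 * (norm x)\<^sup>2" using e(1) by simp
    then show False using key[of x] True by simp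
  next
    case False
    then have c: "0 < c" using c0 by simp
    \<comment> \<open>\<open>key\<close> divided by c^2 shows that d bounds S, and d < c contradicts
      c being the operator norm. The maximum with 0 keeps the root meaningful when e is
      large.\<close>
    define d where "d = sqrt (max 0 (c\<^sup>2 - e\<^sup>2 / c\<^sup>2))"
    have "norm (S x) \<le> d * norm x" for x
    proof (rule power2_le_imp_le)
      have "c\<^sup>2 * (norm (S x))\<^sup>2 \<le> c\<^sup>2 * ((c\<^sup>2 - e\<^sup>2 / c\<^sup>2) * (norm x)\<^sup>2)"
      proof -
        have "c\<^sup>2 * ((c\<^sup>2 - e\<^sup>2 / c\<^sup>2) * (norm x)\<^sup>2) = c\<^sup>2 * (c\<^sup>2 * (norm x)\<^sup>2) - e\<^sup>2 * (norm x)\<^sup>2"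
          using c by (simp add: field_simps)
        then show ?thesis using key[of x] by linarith
      qed
      then have "(norm (S x))\<^sup>2 \<le> (c\<^sup>2 - e\<^sup>2 / c\<^sup>2) * (norm x)\<^sup>2"
        using c by simp
      also have "\<dots> \<le> max 0 (c\<^sup>2 - e\<^sup>2 / c\<^sup>2) * (norm x)\<^sup>2"
        by (intro mult_right_mono) auto
      finally show "(norm (S x))\<^sup>2 \<le> (d * norm x)\<^sup>2"
        by (simp add: d_def power_mult_distrib)
    qed (simp add: d_def)
    then have "c \<le> d"
      unfolding c_def by (intro norm_blinfun_bound) (auto simp: d_def)
    moreover have "d < c"
    proof -
      have "max 0 (c\<^sup>2 - e\<^sup>2 / c\<^sup>2) < c\<^sup>2" using c e(1) by simp
      then have "d < sqrt (c\<^sup>2)" unfolding d_def by (rule real_sqrt_less_mono)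
      then show ?thesis using c by simp
    qed
    ultimately show False by simp
  qed
qed

text \<open>The norm of \<open>p(T)\<close> is controlled by \<open>p\<close> on the spectrum because a number \<open>c\<close> exceeding
  \<open>\<bar>p\<bar>\<close> there makes \<open>c\<^sup>2 - p\<^sup>2\<close> a polynomial without zeros on the spectrum.\<close>

lemma norm_poly_op_le:
  fixes T :: "'a::complex_hilbert \<Rightarrow>\<^sub>L 'a"
  assumes T: "selfadjoint_op T" and e: "0 \<le> e"
    and le: "\<And>t. complex_of_real t \<in> op_spectrum T \<Longrightarrow> \<bar>poly p t\<bar> \<le> e"
  shows "norm (poly_op p T) \<le> e"
proof (rule ccontr)
  assume "\<not> norm (poly_op p T) \<le> e"
  then have less: "e < norm (poly_op p T)" by simp
  \<comment> \<open>On the zero space the spectrum is empty, but p(T) = 0 and the bound is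
    trivial.\<close>
  have nontriv: "\<exists>x::'a. x \<noteq> 0"
  proof (rule ccontr)
    assume "\<not> (\<exists>x::'a. x \<noteq> 0)"
    then have "poly_op p T = 0" by (intro blinfun_eqI) auto
    then show False using less e by simp
  qed
  have nbb: "\<not> bounded_below (poly_op ([:(norm (poly_op r T))\<^sup>2:] - r * r) T)" for r
    using selfadjoint_norm_not_bounded_below[OF selfadjoint_poly_op[OF T] nontriv, of r]
    by (simp add: poly_op_diff poly_op_mult poly_op_const)
  \<comment> \<open>A real spectral point is needed to see that \<open>q\<close> below is not the
    zero polynomial. It comes from the same argument for p = X: \<parallel>T\<parallel>^2 - X^2 is
    nonzero, so it must vanish somewhere on the spectrum.\<close>
  obtain t where t: "complex_of_real t \<in> op_spectrum T"
  proof -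
    have "coeff ([:(norm (poly_op [:0, 1:] T))\<^sup>2:] - [:0, 1:] * [:0, 1:]) 2 = -1"
      by (simp add: numeral_2_eq_2)
    then have "[:(norm (poly_op [:0, 1:] T))\<^sup>2:] - [:0, 1:] * [:0, 1:] \<noteq> 0"
      by (metis coeff_0 zero_neq_neg_one)
    then show ?thesis
      using that bounded_below_poly_op[OF T] nbb by blast
  qed
  define q where "q = [:(norm (poly_op p T))\<^sup>2:] - p * p"
  have q: "poly q s > 0" if "complex_of_real s \<in> op_spectrum T" for s
  proof -
    have "\<bar>poly p s\<bar>\<^sup>2 < (norm (poly_op p T))\<^sup>2"
      using le[OF that] less by (intro power_strict_mono) auto
    then show ?thesis by (simp add: q_def power2_eq_square)
  qed
  then have "q \<noteq> 0" using t by fastforce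
  then have "bounded_below (poly_op q T)"
    using q by (intro bounded_below_poly_op[OF T]) fastforce+
  then show False using nbb[of p] by (simp add: q_def)
qed

section \<open>Continuous functional calculus\<close>

lemma uniform_limit_polynomials:
  fixes f :: "real \<Rightarrow> real"
  assumes "continuous_on {a..b} f"
  shows "\<exists>p :: nat \<Rightarrow> real poly. uniform_limit {a..b} (\<lambda>n t. poly (p n) t) f sequentially"
proof -
  have "\<exists>q. \<forall>x\<in>{a..b}. \<bar>f x - poly q x\<bar> < inverse (real (Suc n))" for n
  proof -
    obtain g where g: "real_polynomial_function g"
      "\<And>x. x \<in> {a..b} \<Longrightarrow> \<bar>f x - g x\<bar> < inverse (real (Suc n))"
      using Stone_Weierstrass_real_polynomial_function[OF compact_Icc assms, of "inverse (real (Suc n))"]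
      by auto
    then obtain c m where "g = (\<lambda>x. \<Sum>i\<le>m. c i * x ^ i)"
      by (auto simp: real_polynomial_function_iff_sum)
    then have "poly (\<Sum>i\<le>m. monom (c i) i) x = g x" for x
      by (simp add: poly_sum poly_monom)
    then show ?thesis using g(2) by metis
  qed
  then obtain p where p: "\<And>n x. x \<in> {a..b} \<Longrightarrow> \<bar>poly (p n) x - f x\<bar> < inverse (real (Suc n))"
    by (metis abs_minus_commute)
  have "uniform_limit {a..b} (\<lambda>n t. poly (p n) t) f sequentially"
  proof (rule uniform_limitI)
    fix e :: real assume "0 < e"
    then have "\<forall>\<^sub>F n in sequentially. inverse (real (Suc n)) < e"
      using LIMSEQ_inverse_real_of_nat by (rule order_tendstoD(2)[rotated])
    then show "\<forall>\<^sub>F n in sequentially. \<forall>x\<in>{a..b}. dist (poly (p n) x) (f x) < e"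
      by eventually_elim (auto simp: dist_real_def intro: less_trans[OF p])
  qed
  then show ?thesis by blast
qed

text \<open>The calculus as a relation with a single witnessing sequence, where
  \<open>op_cfc\<close> asks for all sequences. Witnesses can be multiplied and compared termwise
  without touching \<open>THE\<close>.\<close>

definition cfc_value :: "(real \<Rightarrow> real) \<Rightarrow> ('a::complex_hilbert \<Rightarrow>\<^sub>L 'a) \<Rightarrow> ('a \<Rightarrow>\<^sub>L 'a) \<Rightarrow> bool" where
  "cfc_value f T S \<longleftrightarrow> (\<exists>p :: nat \<Rightarrow> real poly.
     uniform_limit {t. complex_of_real t \<in> op_spectrum T} (\<lambda>n t. poly (p n) t) f sequentially \<and>
     (\<lambda>n. poly_op (p n) T) \<longlonglongrightarrow> S)"

text \<open>One estimate for three purposes: p = q and e = 0 gives the Cauchy property, e = 0 gives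
  independence of the sequence, and general e gives continuity of the calculus in the
  function.\<close>

lemma norm_poly_op_diff_eventually_le:
  fixes T :: "'a::complex_hilbert \<Rightarrow>\<^sub>L 'a"
  defines "K \<equiv> {t. complex_of_real t \<in> op_spectrum T}"
  assumes T: "selfadjoint_op T" and d: "0 < d" and e: "0 \<le> e"
    and p: "uniform_limit K (\<lambda>n t. poly (p n) t) f sequentially"
    and q: "uniform_limit K (\<lambda>n t. poly (q n) t) g sequentially"
    and fg: "\<And>t. t \<in> K \<Longrightarrow> \<bar>f t - g t\<bar> \<le> e"
  shows "\<exists>N. \<forall>m\<ge>N. \<forall>n\<ge>N. norm (poly_op (p m) T - poly_op (q n) T) \<le> e + d"
proof -
  have "\<forall>\<^sub>F n in sequentially. (\<forall>t\<in>K. dist (poly (p n) t) (f t) < d / 2) \<and>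
      (\<forall>t\<in>K. dist (poly (q n) t) (g t) < d / 2)"
    by (intro eventually_conj uniform_limitD[OF p] uniform_limitD[OF q] half_gt_zero d)
  then obtain N where N: "\<And>n t. n \<ge> N \<Longrightarrow> t \<in> K \<Longrightarrow> \<bar>poly (p n) t - f t\<bar> < d / 2"
      "\<And>n t. n \<ge> N \<Longrightarrow> t \<in> K \<Longrightarrow> \<bar>poly (q n) t - g t\<bar> < d / 2"
    by (auto simp: eventually_sequentially dist_real_def)
  have "norm (poly_op (p m) T - poly_op (q n) T) \<le> e + d" if mn: "m \<ge> N" "n \<ge> N" for m n
  proof -
    have "\<bar>poly (p m - q n) t\<bar> \<le> e + d" if "complex_of_real t \<in> op_spectrum T" for t
    proof -
      have "t \<in> K" using that by (simp add: K_def)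
      then have "\<bar>poly (p m) t - f t\<bar> < d / 2" "\<bar>poly (q n) t - g t\<bar> < d / 2" "\<bar>f t - g t\<bar> \<le> e"
        using N(1)[OF mn(1)] N(2)[OF mn(2)] fg by auto
      then show ?thesis unfolding poly_diff by arith
    qed
    then have "norm (poly_op (p m - q n) T) \<le> e + d"
      using d e by (intro norm_poly_op_le[OF T]) auto
    then show ?thesis by (simp add: poly_op_diff)
  qed
  then show ?thesis by blast
qed

lemma norm_cfc_value_diff_le:
  fixes T :: "'a::complex_hilbert \<Rightarrow>\<^sub>L 'a"
  assumes T: "selfadjoint_op T" and e: "0 \<le> e"
    and S: "cfc_value f T S" and R: "cfc_value g T R"
    and fg: "\<And>t. complex_of_real t \<in> op_spectrum T \<Longrightarrow> \<bar>f t - g t\<bar> \<le> e"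
  shows "norm (S - R) \<le> e"
proof (rule field_le_epsilon)
  fix d :: real assume d: "0 < d"
  let ?K = "{t. complex_of_real t \<in> op_spectrum T}"
  obtain p q where p: "uniform_limit ?K (\<lambda>n t. poly (p n) t) f sequentially"
      "(\<lambda>n. poly_op (p n) T) \<longlonglongrightarrow> S"
    and q: "uniform_limit ?K (\<lambda>n t. poly (q n) t) g sequentially"
      "(\<lambda>n. poly_op (q n) T) \<longlonglongrightarrow> R"
    using S R unfolding cfc_value_def by blast
  obtain N where "\<forall>m\<ge>N. \<forall>n\<ge>N. norm (poly_op (p m) T - poly_op (q n) T) \<le> e + d"
    using norm_poly_op_diff_eventually_le[OF T d e p(1) q(1)] fg by auto
  then have "\<forall>n\<ge>N. norm (poly_op (p n) T - poly_op (q n) T) \<le> e + d"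
    by blast
  moreover have "(\<lambda>n. norm (poly_op (p n) T - poly_op (q n) T)) \<longlonglongrightarrow> norm (S - R)"
    by (intro tendsto_intros p q)
  ultimately show "norm (S - R) \<le> e + d"
    by (intro LIMSEQ_le_const2) auto
qed

text \<open>This transfers identities between real functions on the spectrum to identities between
  operators.\<close>

lemma cfc_value_unique:
  assumes "selfadjoint_op T" "cfc_value f T S" "cfc_value g T R"
    and "\<And>t. complex_of_real t \<in> op_spectrum T \<Longrightarrow> f t = g t"
  shows "S = R"
  using norm_cfc_value_diff_le[OF assms(1) _ assms(2,3), of 0] assms(4) by simp

lemma op_cfc_eq:
  fixes T :: "'a::complex_hilbert \<Rightarrow>\<^sub>L 'a"
  assumes T: "selfadjoint_op T" and S: "cfc_value f T S"
  shows "op_cfc f T = S"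
proof -
  let ?K = "{t. complex_of_real t \<in> op_spectrum T}"
  obtain p where p: "uniform_limit ?K (\<lambda>n t. poly (p n) t) f sequentially"
      "(\<lambda>n. poly_op (p n) T) \<longlonglongrightarrow> S"
    using S unfolding cfc_value_def by blast
  show ?thesis
    unfolding op_cfc_def
  proof (rule the_equality, intro allI impI)
    fix q :: "nat \<Rightarrow> real poly"
    assume q: "uniform_limit ?K (\<lambda>n t. poly (q n) t) f sequentially"
    have "(\<lambda>n. poly_op (q n) T - poly_op (p n) T) \<longlonglongrightarrow> 0"
    proof (rule LIMSEQ_I)
      fix r :: real assume r: "0 < r"
      then obtain N where "\<forall>m\<ge>N. \<forall>n\<ge>N. norm (poly_op (q m) T - poly_op (p n) T) \<le> 0 + r / 2"
        using norm_poly_op_diff_eventually_le[OF T _ order_refl q p(1), of "r / 2"] by auto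
      then show "\<exists>N. \<forall>n\<ge>N. norm (poly_op (q n) T - poly_op (p n) T - 0) < r"
        using r by (intro exI[of _ N]) fastforce
    qed
    from tendsto_add[OF this p(2)] show "(\<lambda>n. poly_op (q n) T) \<longlonglongrightarrow> S"
      by simp
  next
    fix R assume "\<forall>p. uniform_limit ?K (\<lambda>n t. poly (p n) t) f sequentially \<longrightarrow>
      (\<lambda>n. poly_op (p n) T) \<longlonglongrightarrow> R"
    then have "(\<lambda>n. poly_op (p n) T) \<longlonglongrightarrow> R" using p(1) by blast
    then show "R = S" using p(2) by (rule LIMSEQ_unique)
  qed
qed

text \<open>Existence of the limit: polynomials from Stone-Weierstrass on the enclosing interval,
  restricted to the spectrum, give a Cauchy sequence of operators.\<close>

lemma cfc_value_op_cfc: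
  fixes T :: "'a::complex_hilbert \<Rightarrow>\<^sub>L 'a"
  assumes T: "selfadjoint_op T"
    and K: "{t. complex_of_real t \<in> op_spectrum T} \<subseteq> {a..b}" and f: "continuous_on {a..b} f"
  shows "cfc_value f T (op_cfc f T)"
proof -
  let ?K = "{t. complex_of_real t \<in> op_spectrum T}"
  obtain p :: "nat \<Rightarrow> real poly" where "uniform_limit {a..b} (\<lambda>n t. poly (p n) t) f sequentially"
    using uniform_limit_polynomials[OF f] by blast
  then have p: "uniform_limit ?K (\<lambda>n t. poly (p n) t) f sequentially"
    using K by (rule uniform_limit_on_subset)
  have "Cauchy (\<lambda>n. poly_op (p n) T)"
  proof (rule CauchyI)
    fix r :: real assume r: "0 < r"
    then obtain N where "\<forall>m\<ge>N. \<forall>n\<ge>N. norm (poly_op (p m) T - poly_op (p n) T) \<le> 0 + r / 2"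
      using norm_poly_op_diff_eventually_le[OF T _ order_refl p p, of "r / 2"] by auto
    then show "\<exists>M. \<forall>m\<ge>M. \<forall>n\<ge>M. norm (poly_op (p m) T - poly_op (p n) T) < r"
      using r by (intro exI[of _ N]) fastforce
  qed
  then obtain S where "(\<lambda>n. poly_op (p n) T) \<longlonglongrightarrow> S"
    by (auto simp: Cauchy_convergent_iff convergent_def)
  then have "cfc_value f T S" using p unfolding cfc_value_def by blast
  then show ?thesis using op_cfc_eq[OF T] by simp
qed

lemma cfc_value_poly: "cfc_value (poly p) T (poly_op p T)"
  unfolding cfc_value_def by (rule exI[of _ "\<lambda>_. p"]) (simp add: uniform_limit_const)

lemma cfc_value_mult:
  fixes T :: "'a::complex_hilbert \<Rightarrow>\<^sub>L 'a"
  assumes "cfc_value f T S" "cfc_value g T R"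
    and "bounded (f ` {t. complex_of_real t \<in> op_spectrum T})"
    and "bounded (g ` {t. complex_of_real t \<in> op_spectrum T})"
  shows "cfc_value (\<lambda>t. f t * g t) T (S o\<^sub>L R)"
proof -
  let ?K = "{t. complex_of_real t \<in> op_spectrum T}"
  obtain p q where p: "uniform_limit ?K (\<lambda>n t. poly (p n) t) f sequentially"
      "(\<lambda>n. poly_op (p n) T) \<longlonglongrightarrow> S"
    and q: "uniform_limit ?K (\<lambda>n t. poly (q n) t) g sequentially"
      "(\<lambda>n. poly_op (q n) T) \<longlonglongrightarrow> R"
    using assms(1,2) unfolding cfc_value_def by blast
  have "uniform_limit ?K (\<lambda>n t. poly (p n) t * poly (q n) t) (\<lambda>t. f t * g t) sequentially"
    by (rule uniform_lim_mult[OF p(1) q(1) assms(3,4)])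
  then have "uniform_limit ?K (\<lambda>n t. poly (p n * q n) t) (\<lambda>t. f t * g t) sequentially"
    by simp
  moreover have "(\<lambda>n. poly_op (p n * q n) T) \<longlonglongrightarrow> (S o\<^sub>L R)"
    unfolding poly_op_mult
    by (rule bounded_bilinear.tendsto[OF bounded_bilinear_blinfun_compose p(2) q(2)])
  ultimately show ?thesis
    unfolding cfc_value_def by (intro exI[of _ "\<lambda>n. p n * q n"] conjI)
qed

lemma selfadjoint_cfc_value:
  assumes "selfadjoint_op T" "cfc_value f T S"
  shows "selfadjoint_op S"
  using assms unfolding cfc_value_def by (meson selfadjoint_op_lim selfadjoint_poly_op)

lemma positive_invertible_spectrum:
  fixes T :: "'a::complex_hilbert \<Rightarrow>\<^sub>L 'a"
  assumes "positive_op T" "invertible_op T"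
  obtains a b where "0 < a" "{t. complex_of_real t \<in> op_spectrum T} \<subseteq> {a..b}"
proof -
  obtain \<alpha> where "0 < \<alpha>" "\<And>x. \<alpha> * (norm x)\<^sup>2 \<le> inner (T x) x"
    using positive_invertible_coercive[OF assms] by blast
  moreover have "T \<in> bounded_ops"
    using assms by (simp add: positive_op_def selfadjoint_op_bounded_ops)
  ultimately show ?thesis
    using that[of \<alpha> "norm T"] spectrum_bounds[of T \<alpha>] by blast
qed

section \<open>Real powers of a positive invertible operator\<close>

context
  fixes T :: "'a::complex_hilbert \<Rightarrow>\<^sub>L 'a"
  assumes T: "positive_op T" "invertible_op T"
begin

lemma spectrum_pos: "complex_of_real t \<in> op_spectrum T \<Longrightarrow> 0 < t"
proof -
  assume t: "complex_of_real t \<in> op_spectrum T"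
  obtain a b where "0 < a" "{t. complex_of_real t \<in> op_spectrum T} \<subseteq> {a..b}"
    using positive_invertible_spectrum[OF T] .
  then have "0 < a" "t \<in> {a..b}" using t by auto
  then show ?thesis by simp
qed

lemma cfc_value_powr: "cfc_value (\<lambda>t. t powr s) T (op_powr T s)"
proof -
  obtain a b where "0 < a" "{t. complex_of_real t \<in> op_spectrum T} \<subseteq> {a..b}"
    using positive_invertible_spectrum[OF T] .
  then show ?thesis
    unfolding op_powr_def
    by (intro cfc_value_op_cfc[OF positive_op_selfadjoint[OF T(1)], of a b]) (auto intro!: continuous_intros)
qed

lemma selfadjoint_op_powr: "selfadjoint_op (op_powr T s)"
  by (rule selfadjoint_cfc_value[OF positive_op_selfadjoint[OF T(1)] cfc_value_powr])

lemma op_powr_0: "op_powr T 0 = id_blinfun"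
proof -
  have "op_powr T 0 = poly_op [:1:] T"
    \<comment> \<open>Positivity of the spectrum matters here: \<open>t powr 0\<close> is 1 for t
      \<noteq> 0, but \<open>0 powr 0\<close> is 0.\<close>
    by (rule cfc_value_unique[OF positive_op_selfadjoint[OF T(1)] cfc_value_powr cfc_value_poly])
      (drule spectrum_pos, simp)
  then show ?thesis by (simp add: poly_op_const)
qed

lemma op_powr_1: "op_powr T 1 = T"
proof -
  have "op_powr T 1 = poly_op [:0, 1:] T"
    by (rule cfc_value_unique[OF positive_op_selfadjoint[OF T(1)] cfc_value_powr cfc_value_poly])
      (drule spectrum_pos, simp)
  then show ?thesis by (simp add: poly_op_X)
qed

lemma op_powr_add: "op_powr T (s + r) = op_powr T s o\<^sub>L op_powr T r"
proof -
  obtain a b where ab: "0 < a" "{t. complex_of_real t \<in> op_spectrum T} \<subseteq> {a..b}"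
    using positive_invertible_spectrum[OF T] .
  have bdd: "bounded ((\<lambda>t. t powr u) ` {t. complex_of_real t \<in> op_spectrum T})" for u
  proof (rule bounded_subset)
    show "bounded ((\<lambda>t. t powr u) ` {a..b})"
      using ab(1) by (intro compact_imp_bounded compact_continuous_image continuous_intros) auto
  qed (use ab(2) in auto)
  show ?thesis
    by (rule cfc_value_unique[OF positive_op_selfadjoint[OF T(1)] cfc_value_powr
          cfc_value_mult[OF cfc_value_powr cfc_value_powr bdd bdd]])
      (simp add: powr_add)
qed

text \<open>The map (t, s) |-> t^s is uniformly continuous on a compact rectangle over an interval
  around the spectrum, so a small change of exponent moves the function uniformly little and the
  calculus carries this to the norm.\<close>

lemma isCont_op_powr: "isCont (op_powr T) \<nu>"
  unfolding continuous_at_eps_delta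
proof (intro allI impI)
  fix e :: real assume e: "0 < e"
  obtain a b where ab: "0 < a" "{t. complex_of_real t \<in> op_spectrum T} \<subseteq> {a..b}"
    using positive_invertible_spectrum[OF T] .
  have "uniformly_continuous_on ({a..b} \<times> {\<nu>-1..\<nu>+1}) (\<lambda>z. fst z powr snd z)"
    using ab(1) by (intro compact_uniformly_continuous compact_Times continuous_intros) auto
  then obtain d where d: "d > 0" "\<And>z w. z \<in> {a..b} \<times> {\<nu>-1..\<nu>+1} \<Longrightarrow> w \<in> {a..b} \<times> {\<nu>-1..\<nu>+1}
      \<Longrightarrow> dist w z < d \<Longrightarrow> dist (fst w powr snd w) (fst z powr snd z) < e / 2"
    unfolding uniformly_continuous_on_def using e by (meson half_gt_zero)
  \<comment> \<open>The 1 in the minimum keeps the exponent inside the rectangle. The calculus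
    yields only a non-strict bound, hence e / 2.\<close>
  have close: "norm (op_powr T x - op_powr T \<nu>) \<le> e / 2" if x: "dist x \<nu> < min d 1" for x
  proof (rule norm_cfc_value_diff_le[OF positive_op_selfadjoint[OF T(1)] _ cfc_value_powr cfc_value_powr])
    fix t assume "complex_of_real t \<in> op_spectrum T"
    then have "t \<in> {a..b}" using ab(2) by auto
    moreover have "x \<in> {\<nu>-1..\<nu>+1}"
      using x by (simp add: dist_real_def abs_diff_less_iff)
    ultimately show "\<bar>t powr x - t powr \<nu>\<bar> \<le> e / 2"
      using d(2)[of "(t, \<nu>)" "(t, x)"] x by (simp add: dist_Pair_Pair dist_real_def)
  qed (use e in auto)
  show "\<exists>d>0. \<forall>x. dist x \<nu> < d \<longrightarrow> dist (op_powr T x) (op_powr T \<nu>) < e"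
  proof (intro exI[of _ "min d 1"] conjI allI impI)
    show "dist (op_powr T x) (op_powr T \<nu>) < e" if "dist x \<nu> < min d 1" for x
      using close[OF that] e by (simp add: dist_norm)
  qed (use d(1) in simp)
qed

end

section \<open>Dyadic interpolation\<close>

text \<open>Doubling reads off one binary digit: it is 1 exactly when the fractional part is at
  least 1/2, and it is carried into the floor.\<close>

lemma frac_double:
  "frac (2 * x) = (if frac x < 1 / 2 then 2 * frac x else 2 * frac x - 1)"
  "\<lfloor>2 * x\<rfloor> = (if frac x < 1 / 2 then 2 * \<lfloor>x\<rfloor> else 2 * \<lfloor>x\<rfloor> + 1)"
  for x :: real
proof -
  have fl: "\<lfloor>2 * x\<rfloor> = (if frac x < 1 / 2 then 2 * \<lfloor>x\<rfloor> else 2 * \<lfloor>x\<rfloor> + 1)"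
    by (rule floor_unique) (use frac_lt_1[of x] in \<open>auto simp: frac_def\<close>)
  then show "\<lfloor>2 * x\<rfloor> = (if frac x < 1 / 2 then 2 * \<lfloor>x\<rfloor> else 2 * \<lfloor>x\<rfloor> + 1)" .
  show "frac (2 * x) = (if frac x < 1 / 2 then 2 * frac x else 2 * frac x - 1)"
    using fl by (simp add: frac_def)
qed

text \<open>The recursion is the doubling map modulo 1 seen through \<theta> |-> min \<theta> (1 -
  \<theta>): \<theta> and 1 - \<theta> have doubles at the same distance from the integers.\<close>

lemma r_seq_eq:
  assumes "0 < \<nu>" "\<nu> < 1"
  shows "r_seq \<nu> k = min (frac (2 ^ k * \<nu>)) (1 - frac (2 ^ k * \<nu>))"
proof (induction k)
  case 0
  have "frac \<nu> = \<nu>" using assms by (simp add: frac_eq)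
  then show ?case by simp
next
  case (Suc k)
  have "2 ^ Suc k * \<nu> = 2 * (2 ^ k * \<nu>)" by simp
  then show ?case
    using Suc frac_lt_1[of "2 ^ k * \<nu>"] frac_ge_0[of "2 ^ k * \<nu>"]
    by (simp only: r_seq.simps frac_double) (auto simp: min_def)
qed

text \<open>Continuity at \<nu> controls the limit because both nodes lie within 2^-k of \<nu>. With
  G abstract, operators enter only through the end values and the continuity of
  \<open>geom_mean\<close>.\<close>

lemma dyadic_interpolation_sums:
  fixes G :: "real \<Rightarrow> 'v::real_normed_vector"
  assumes \<nu>: "0 < \<nu>" "\<nu> < 1" and G: "isCont G \<nu>"
  shows "(\<lambda>k. r_seq \<nu> k *\<^sub>R (G (of_int (m_seq \<nu> k) / 2 ^ k)
      - 2 *\<^sub>R G (of_int (2 * m_seq \<nu> k + 1) / 2 ^ (k + 1))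
      + G (of_int (m_seq \<nu> k + 1) / 2 ^ k)))
    sums ((1 - \<nu>) *\<^sub>R G 0 + \<nu> *\<^sub>R G 1 - G \<nu>)"
proof -
  define \<theta> where "\<theta> k = frac (2 ^ k * \<nu>)" for k
  define l where "l k = real_of_int (m_seq \<nu> k) / 2 ^ k" for k
  define u where "u k = real_of_int (m_seq \<nu> k + 1) / 2 ^ k" for k
  \<comment> \<open>The value at \<nu> of the chord of G from \<open>l k\<close> to
    \<open>u k\<close>; \<open>\<theta> k\<close> is the relative position of \<nu> between these
    nodes.\<close>
  define L where "L k = (1 - \<theta> k) *\<^sub>R G (l k) + \<theta> k *\<^sub>R G (u k)" for k
  have \<theta>: "0 \<le> \<theta> k" "\<theta> k < 1" for k by (auto simp: \<theta>_def frac_lt_1)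
  have step: "r_seq \<nu> k *\<^sub>R (G (l k) - 2 *\<^sub>R G (of_int (2 * m_seq \<nu> k + 1) / 2 ^ (k + 1)) + G (u k))
      = L k - L (Suc k)" for k
  proof -
    define mid where "mid = real_of_int (2 * m_seq \<nu> k + 1) / 2 ^ (k + 1)"
    have double: "2 ^ Suc k * \<nu> = 2 * (2 ^ k * \<nu>)" by simp
    have two: "(2 * \<theta> k) *\<^sub>R v = \<theta> k *\<^sub>R v + \<theta> k *\<^sub>R v" for v :: 'v
      by (simp flip: scaleR_add_left)
    show ?thesis
    \<comment> \<open>Refinement keeps the half containing \<nu>, and the midpoint replaces the
      other end. In both cases \<open>r_seq \<nu> k\<close> is the weight that the old chord gave to
      the discarded end.\<close>
    proof (cases "\<theta> k < 1 / 2")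
      case True
      have \<theta>': "\<theta> (Suc k) = 2 * \<theta> k" and m: "m_seq \<nu> (Suc k) = 2 * m_seq \<nu> k"
        using True unfolding \<theta>_def m_seq_def double frac_double by simp_all
      have lu: "l (Suc k) = l k" "u (Suc k) = mid"
        by (simp_all add: l_def u_def m mid_def)
      have r: "r_seq \<nu> k = \<theta> k"
        using True r_seq_eq[OF \<nu>, of k] by (simp add: \<theta>_def)
      have "L k - L (Suc k) = \<theta> k *\<^sub>R (G (l k) - 2 *\<^sub>R G mid + G (u k))"
        unfolding L_def lu \<theta>' scaleR_left_diff_distrib two
        by (simp add: scaleR_right_distrib scaleR_right_diff_distrib scaleR_2)
      then show ?thesis by (simp only: r mid_def)
    next
      case False
      have \<theta>': "\<theta> (Suc k) = 2 * \<theta> k - 1" and m: "m_seq \<nu> (Suc k) = 2 * m_seq \<nu> k + 1"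
        using False unfolding \<theta>_def m_seq_def double frac_double by simp_all
      have lu: "l (Suc k) = mid" "u (Suc k) = u k"
        by (simp_all add: l_def u_def m mid_def field_simps)
      have r: "r_seq \<nu> k = 1 - \<theta> k"
        using False r_seq_eq[OF \<nu>, of k] by (simp add: \<theta>_def)
      have "L k - L (Suc k) = (1 - \<theta> k) *\<^sub>R (G (l k) - 2 *\<^sub>R G mid + G (u k))"
        unfolding L_def lu \<theta>' scaleR_left_diff_distrib two
        by (simp add: scaleR_right_distrib scaleR_right_diff_distrib scaleR_2)
      then show ?thesis by (simp only: r mid_def)
    qed
  qed
  have near: "\<bar>l k - \<nu>\<bar> \<le> (1 / 2) ^ k" "\<bar>u k - \<nu>\<bar> \<le> (1 / 2) ^ k" for k
  proof -
    have "real_of_int (m_seq \<nu> k) = 2 ^ k * \<nu> - \<theta> k"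
      by (simp add: m_seq_def \<theta>_def frac_def)
    then have "l k - \<nu> = - \<theta> k * (1 / 2) ^ k" "u k - \<nu> = (1 - \<theta> k) * (1 / 2) ^ k"
      by (simp_all add: l_def u_def power_one_over diff_divide_distrib add_divide_distrib left_diff_distrib)
    then show "\<bar>l k - \<nu>\<bar> \<le> (1 / 2) ^ k" "\<bar>u k - \<nu>\<bar> \<le> (1 / 2) ^ k"
      using \<theta>[of k] by (simp_all add: abs_mult mult_left_le_one_le)
  qed
  have lim: "X \<longlonglongrightarrow> \<nu>" if "\<And>k. \<bar>X k - \<nu>\<bar> \<le> (1 / 2) ^ k" for X :: "nat \<Rightarrow> real"
  proof (rule LIM_zero_cancel, rule Lim_null_comparison)
    show "\<forall>\<^sub>F k in sequentially. norm (X k - \<nu>) \<le> (1 / 2) ^ k"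
      using that by simp
    show "(\<lambda>k. (1 / 2) ^ k :: real) \<longlonglongrightarrow> 0"
      by (rule LIMSEQ_power_zero) simp
  qed
  have GX: "(\<lambda>k. norm (G (X k) - G \<nu>)) \<longlonglongrightarrow> 0" if "X \<longlonglongrightarrow> \<nu>" for X
    using isCont_tendsto_compose[OF G that] by (simp add: LIM_zero tendsto_norm_zero)
  have "L \<longlonglongrightarrow> G \<nu>"
  proof (rule LIM_zero_cancel, rule Lim_null_comparison)
    have "norm (L k - G \<nu>) \<le> norm (G (l k) - G \<nu>) + norm (G (u k) - G \<nu>)" for k
    proof -
      \<comment> \<open>The weights add up to 1, so the error is a convex combination of the errors
        at the two nodes.\<close>
      have "L k - G \<nu> = (1 - \<theta> k) *\<^sub>R (G (l k) - G \<nu>) + \<theta> k *\<^sub>R (G (u k) - G \<nu>)"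
        by (simp add: L_def algebra_simps)
      also have "norm \<dots> \<le> (1 - \<theta> k) * norm (G (l k) - G \<nu>) + \<theta> k * norm (G (u k) - G \<nu>)"
        using \<theta>[of k] by (intro order_trans[OF norm_triangle_ineq]) simp
      also have "\<dots> \<le> 1 * norm (G (l k) - G \<nu>) + 1 * norm (G (u k) - G \<nu>)"
        using \<theta>[of k] by (intro add_mono mult_right_mono) auto
      finally show ?thesis by simp
    qed
    then show "\<forall>\<^sub>F k in sequentially. norm (L k - G \<nu>) \<le> norm (G (l k) - G \<nu>) + norm (G (u k) - G \<nu>)"
      by simp
    show "(\<lambda>k. norm (G (l k) - G \<nu>) + norm (G (u k) - G \<nu>)) \<longlonglongrightarrow> 0"
      using tendsto_add[OF GX[OF lim[OF near(1)]] GX[OF lim[OF near(2)]]] by simp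
  qed
  then have "(\<lambda>k. L k - L (Suc k)) sums (L 0 - G \<nu>)"
    by (rule telescope_sums')
  moreover have "L 0 = (1 - \<nu>) *\<^sub>R G 0 + \<nu> *\<^sub>R G 1"
  proof -
    have "\<lfloor>\<nu>\<rfloor> = 0" "frac \<nu> = \<nu>" using \<nu> by (auto simp: floor_eq_iff frac_eq)
    then show ?thesis by (simp add: L_def l_def u_def \<theta>_def m_seq_def)
  qed
  ultimately show ?thesis
    by (simp only: step[symmetric] l_def u_def)
qed

section \<open>Geometric means\<close>

lemma sot_suminf_eq:
  assumes "sot_sums F S"
  shows "sot_suminf F = S"
  unfolding sot_suminf_def
proof (rule the_equality)
  show "R = S" if "sot_sums F R" for R
    using assms that unfolding sot_sums_def by (intro blinfun_eqI) (blast intro: sums_unique2)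
qed (rule assms)

text \<open>Evaluation at a vector is bounded linear in the operator, so norm convergence implies
  strong convergence to the same sum.\<close>

lemma sums_imp_sot_sums: "F sums S \<Longrightarrow> sot_sums F S"
  unfolding sot_sums_def by (intro allI bounded_linear.sums[OF blinfun.bounded_linear_left])

lemma positive_op_sandwich:
  assumes S: "selfadjoint_op S" and T: "positive_op T"
  shows "positive_op (S o\<^sub>L T o\<^sub>L S)"
  using assms by (simp add: positive_op_iff selfadjoint_op_sandwich selfadjoint_op_inner[OF S])

lemma invertible_op_compose:
  assumes "invertible_op S" "invertible_op T"
  shows "invertible_op (S o\<^sub>L T)"
proof -
  obtain S' T' where S': "S' \<in> bounded_ops" "S' o\<^sub>L S = id_blinfun" "S o\<^sub>L S' = id_blinfun"
    and T': "T' \<in> bounded_ops" "T' o\<^sub>L T = id_blinfun" "T o\<^sub>L T' = id_blinfun"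
    using assms unfolding invertible_op_def by blast
  have "(T' o\<^sub>L S') o\<^sub>L (S o\<^sub>L T) = T' o\<^sub>L (S' o\<^sub>L S) o\<^sub>L T"
    "(S o\<^sub>L T) o\<^sub>L (T' o\<^sub>L S') = S o\<^sub>L (T o\<^sub>L T') o\<^sub>L S'"
    by (simp_all only: blinfun_compose_assoc')
  then show ?thesis
    unfolding invertible_op_def using S' T' by (auto intro!: bexI[of _ "T' o\<^sub>L S'"] bounded_ops_compose)
qed

lemma invertible_op_powr:
  assumes "positive_op T" "invertible_op T"
  shows "invertible_op (op_powr T s)"
  unfolding invertible_op_def
proof (intro bexI conjI)
  show "op_powr T (- s) o\<^sub>L op_powr T s = id_blinfun" "op_powr T s o\<^sub>L op_powr T (- s) = id_blinfun"
    using op_powr_add[OF assms, of "- s" s] op_powr_add[OF assms, of s "- s"] op_powr_0[OF assms]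
    by simp_all
  show "op_powr T (- s) \<in> bounded_ops"
    by (rule selfadjoint_op_bounded_ops[OF selfadjoint_op_powr[OF assms]])
qed

context
  fixes A B :: "'a::complex_hilbert \<Rightarrow>\<^sub>L 'a"
  assumes A: "positive_op A" "invertible_op A" and B: "positive_op B" "invertible_op B"
begin

text \<open>This makes the power laws available for the inner power in
  \<open>geom_mean\<close>.\<close>

lemma conjugated_positive_invertible:
  "positive_op (op_powr A (-1/2) o\<^sub>L B o\<^sub>L op_powr A (-1/2))"
  "invertible_op (op_powr A (-1/2) o\<^sub>L B o\<^sub>L op_powr A (-1/2))"
  by (intro positive_op_sandwich selfadjoint_op_powr invertible_op_compose invertible_op_powr A B)+

lemma geom_mean_0: "geom_mean A 0 B = A"
  using op_powr_add[OF A, of "1/2" "1/2"] op_powr_1[OF A]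
  unfolding geom_mean_def op_powr_0[OF conjugated_positive_invertible] by simp

lemma geom_mean_1: "geom_mean A 1 B = B"
proof -
  have inv: "op_powr A (1/2) o\<^sub>L op_powr A (-1/2) = id_blinfun"
    "op_powr A (-1/2) o\<^sub>L op_powr A (1/2) = id_blinfun"
    using op_powr_add[OF A, of "1/2" "-1/2"] op_powr_add[OF A, of "-1/2" "1/2"] op_powr_0[OF A]
    by simp_all
  have "geom_mean A 1 B =
      (op_powr A (1/2) o\<^sub>L op_powr A (-1/2)) o\<^sub>L B o\<^sub>L (op_powr A (-1/2) o\<^sub>L op_powr A (1/2))"
    unfolding geom_mean_def op_powr_1[OF conjugated_positive_invertible]
    by (simp only: blinfun_compose_assoc')
  then show ?thesis by (simp only: inv blinfun_compose_id)
qed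

lemma isCont_geom_mean: "isCont (\<lambda>\<mu>. geom_mean A \<mu> B) \<nu>"
  unfolding geom_mean_def
  by (intro bounded_bilinear.isCont[OF bounded_bilinear_blinfun_compose] continuous_const
      isCont_op_powr conjugated_positive_invertible)

end

theorem theorem3p2:
  fixes A B :: "'a::complex_hilbert \<Rightarrow>\<^sub>L 'a" and \<nu> :: real
  defines "F \<equiv> \<lambda>k::nat. r_seq \<nu> k *\<^sub>R
      (geom_mean A (of_int (m_seq \<nu> k) / 2 ^ k) B
       - 2 *\<^sub>R geom_mean A (of_int (2 * m_seq \<nu> k + 1) / 2 ^ (k + 1)) B
       + geom_mean A (of_int (m_seq \<nu> k + 1) / 2 ^ k) B)"
  assumes "positive_op A" and "invertible_op A"
    and "positive_op B" and "invertible_op B"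
    and "0 < \<nu>" and "\<nu> < 1"
  shows "sot_summable F \<and> geom_mean A \<nu> B + sot_suminf F \<le>\<^sub>o\<^sub>p arith_mean A \<nu> B"
proof -
  note AB = assms(2-5)
  have "F sums ((1 - \<nu>) *\<^sub>R geom_mean A 0 B + \<nu> *\<^sub>R geom_mean A 1 B - geom_mean A \<nu> B)"
    unfolding F_def
    by (rule dyadic_interpolation_sums[OF assms(6,7) isCont_geom_mean[OF AB]])
  then have F: "sot_sums F (arith_mean A \<nu> B - geom_mean A \<nu> B)"
    by (intro sums_imp_sot_sums) (simp add: arith_mean_def geom_mean_0[OF AB] geom_mean_1[OF AB])
  \<comment> \<open>\<open>op_le\<close> includes self-adjointness of both sides, so even its
    reflexivity at the arithmetic mean has to be earned.\<close>
  have "selfadjoint_op (arith_mean A \<nu> B)"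
    using AB by (simp add: arith_mean_def positive_op_def selfadjoint_op_add selfadjoint_op_scaleR)
  moreover have "positive_op (0 :: 'a \<Rightarrow>\<^sub>L 'a)"
    by (simp add: positive_op_iff selfadjoint_op_zero)
  ultimately have "arith_mean A \<nu> B \<le>\<^sub>o\<^sub>p arith_mean A \<nu> B"
    by (simp add: op_le_def)
  then show ?thesis
    using F sot_suminf_eq[OF F] by (auto simp: sot_summable_def)
qed

end
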